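(* A labelled sequent $S$ of Łukasiewicz formulas is derivable in $\mathbf{GŁ_l}$ if and only if $\models^*_{Ł} S$.
   Context: Łukasiewicz formulas are built from propositional variables and $\bot$ using $\Rightarrow$; a valuation $v$ maps them into $[-1,0]$ with $v(\bot)=-1$, $v(A\Rightarrow B)=\min(0,v(B)-v(A))$. Labels are generated from the unit label $1$ and atomic labels $x_1,x_2,\ldots$ by concatenation $xy$. A labelled formula is $x:A$; a labelled sequent $\Gamma\vdash\Delta$ is a pair of finite multisets of labelled formulas. A labelling function $f$ maps labels to $\{0,1\}$ with $f(1)=1$, $f(xy)=f(x)f(y)$; $f(\Gamma)=\{A : x:A\in\Gamma, f(x)=1\}$ (multiset). $\models^*_Ł\Gamma\vdash\Delta$ means: for every valuation $v$ there is a labelling function $f$ with $\sum_{A\in f(\Gamma)}v(A)\le\sum_{B\in f(\Delta)}v(B)$ (real sums). For multisets of atomic formulas (propositional variables and $\bot$), $\Delta\subseteq^*\Gamma$ is defined recursively: $\Delta\subseteq^*\Gamma$ iff either $\Delta\subseteq\Gamma$ (multiset inclusion), or $\Gamma=\Gamma'\uplus\{\bot\}$, $\Delta=\Delta'\uplus\{q\}$ for some atomic $q$, and $\Delta'\subseteq^*\Gamma'$. Calculus $\mathbf{GŁ_l}$: $(\Rightarrow,l)$ from $\Gamma,xy:B\vdash\Delta,xy:A$ infer $\Gamma,x:A\Rightarrow B\vdash\Delta$, where $y$ is an atomic label not occurring in the conclusion; $(\Rightarrow,r)$ from $\Gamma,x:A\vdash\Delta,x:B$ and $\Gamma\vdash\Delta$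 infer $\Gamma\vdash\Delta,x:A\Rightarrow B$; (success) axiom $\Gamma\vdash\Delta$ whenever $\Gamma,\Delta$ contain only atomic formulas and there exist labelling functions $f_1,\ldots,f_n$ ($n\ge1$) with $\biguplus_{i=1}^n f_i(\Delta)\subseteq^*\biguplus_{i=1}^n f_i(\Gamma)$. *)

theory Defs
  imports Complex_Main "HOL-Library.Multiset"
begin

datatype form = Var nat | Bot ("\<bottom>\<^sub>L") | Imp form form (infixr "\<Rightarrow>\<^sub>L" 60)

fun atomic :: "form \<Rightarrow> bool" where
  "atomic (Var p) = True"
| "atomic \<bottom>\<^sub>L = True"
| "atomic (A \<Rightarrow>\<^sub>L B) = False"

definition valuation :: "(form \<Rightarrow> real) \<Rightarrow> bool" where
  "valuation v \<longleftrightarrow>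
     (\<forall>A. v A \<in> {-1..0}) \<and>
     v \<bottom>\<^sub>L = -1 \<and>
     (\<forall>A B. v (A \<Rightarrow>\<^sub>L B) = min 0 (v B - v A))"

text \<open>
  Labels are kept as syntactic terms: concatenation is not quotiented by the
  monoid laws. Labelling functions respect those laws anyway.
\<close>

datatype label = One | Atom nat | Conc label label (infixl "\<cdot>" 75)

primrec atoms :: "label \<Rightarrow> nat set" where
  "atoms One = {}"
| "atoms (Atom k) = {k}"
| "atoms (x \<cdot> y) = atoms x \<union> atoms y"

type_synonym lform = "label \<times> form"
type_synonym sequent = "lform multiset \<times> lform multiset"

definition occurs_in :: "nat \<Rightarrow> sequent \<Rightarrow> bool" where
  "occurs_in k S \<longleftrightarrow> (\<exists>(x, A) \<in># fst S + snd S. k \<in> atoms x)"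

definition labelling :: "(label \<Rightarrow> nat) \<Rightarrow> bool" where
  "labelling f \<longleftrightarrow>
     (\<forall>x. f x \<in> {0, 1}) \<and>
     f One = 1 \<and>
     (\<forall>x y. f (x \<cdot> y) = f x * f y)"

definition select :: "(label \<Rightarrow> nat) \<Rightarrow> lform multiset \<Rightarrow> form multiset" where
  "select f \<Gamma> = image_mset snd {# (x, A) \<in># \<Gamma>. f x = 1 #}"

definition valid :: "sequent \<Rightarrow> bool" ("\<Turnstile>\<^sup>* _" [50] 50) where
  "valid S \<longleftrightarrow>
     (\<forall>v. valuation v \<longrightarrow>
        (\<exists>f. labelling f \<and>
           (\<Sum>A \<in># select f (fst S). v A) \<le> (\<Sum>B \<in># select f (snd S). v B)))"

inductive substar :: "form multiset \<Rightarrow> form multiset \<Rightarrow> bool" (infix "\<subseteq>\<^sup>*" 50) where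
  incl: "\<Delta> \<subseteq># \<Gamma> \<Longrightarrow> \<Delta> \<subseteq>\<^sup>* \<Gamma>"
| bot: "atomic q \<Longrightarrow> \<Delta> \<subseteq>\<^sup>* \<Gamma> \<Longrightarrow> add_mset q \<Delta> \<subseteq>\<^sup>* add_mset \<bottom>\<^sub>L \<Gamma>"

inductive derivable :: "sequent \<Rightarrow> bool" where
  impL: "derivable (add_mset (x \<cdot> Atom y, B) \<Gamma>, add_mset (x \<cdot> Atom y, A) \<Delta>) \<Longrightarrow>
         \<not> occurs_in y (add_mset (x, A \<Rightarrow>\<^sub>L B) \<Gamma>, \<Delta>) \<Longrightarrow>
         derivable (add_mset (x, A \<Rightarrow>\<^sub>L B) \<Gamma>, \<Delta>)"
| impR: "derivable (add_mset (x, A) \<Gamma>, add_mset (x, B) \<Delta>) \<Longrightarrow>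
         derivable (\<Gamma>, \<Delta>) \<Longrightarrow>
         derivable (\<Gamma>, add_mset (x, A \<Rightarrow>\<^sub>L B) \<Delta>)"
| success: "\<forall>(x :: label, A) \<in># \<Gamma> + \<Delta>. atomic A \<Longrightarrow>
            (n :: nat) \<ge> 1 \<Longrightarrow>
            \<forall>i \<in> {1..n}. labelling (f i) \<Longrightarrow>
            (\<Sum>i = 1..n. select (f i) \<Delta>) \<subseteq>\<^sup>* (\<Sum>i = 1..n. select (f i) \<Gamma>) \<Longrightarrow>
            derivable (\<Gamma>, \<Delta>)"

end

theory Submission
  imports Defs
begin

text \<open>
  Both logical rules preserve and reflect validity and shrink the sequent, so everything reduces
  to atomic sequents. If an atomic sequent is valid, then, with \<open>u p = - v p\<close>, the strict
  linear inequalities ``labelling \<open>f\<close> fails'' (one for each of the finitely many ways in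
  which a labelling selects formulas) have no common solution in the unit cube. Fourier--Motzkin
  elimination over the integers turns this into a nonempty list of labellings for which the
  surplus of \<open>\<bottom>\<^sub>L\<close> on the left is at least the total excess of variables on the
  right. This is precisely the multiset condition of the success rule.
\<close>

section \<open>Strict integer inequalities over the unit cube\<close>

text \<open>A pair \<open>(a, b)\<close> encodes the strict inequality
  \<open>(\<Sum>q. a q * u q) + b < 0\<close>. Only addition is allowed, so positive integer
  multipliers become repetitions; each summand can later be read as one labelling of the success
  rule.\<close>

inductive comb :: "(('k \<Rightarrow> int) \<times> int) set \<Rightarrow> ('k \<Rightarrow> int) \<Rightarrow> int \<Rightarrow> bool"
  for C where
  comb_base: "(a, b) \<in> C \<Longrightarrow> comb C a b"
| comb_add: "comb C a b \<Longrightarrow> comb C a' b' \<Longrightarrow> comb C (\<lambda>q. a q + a' q) (b + b')"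

lemma comb_scale:
  assumes "comb C a b" and "n > 0"
  shows "comb C (\<lambda>q. int n * a q) (int n * b)"
  using assms(2)
proof (induction n rule: nat_induct_non_zero)
  case 1
  then show ?case using assms(1) by simp
next
  case (Suc n)
  from comb_add[OF assms(1) Suc.IH] show ?case
    by (simp add: algebra_simps)
qed

text \<open>The bounds range over every \<open>q\<close>, so that a solution yields a valuation at
  once. Coefficients outside \<open>K\<close> are ignored, hence an eliminated variable may keep its
  coefficient.\<close>

definition feasible :: "'k set \<Rightarrow> (('k \<Rightarrow> int) \<times> int) set \<Rightarrow> ('k \<Rightarrow> real) \<Rightarrow> bool" where
  "feasible K C u \<longleftrightarrow> (\<forall>q. 0 \<le> u q \<and> u q \<le> 1) \<and>
     (\<forall>(a, b) \<in> C. (\<Sum>q\<in>K. of_int (a q) * u q) + of_int b < 0)"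

lemma finite_interval_gap:
  fixes L U :: "real set"
  assumes "finite L" "finite U" "\<And>l m. l \<in> L \<Longrightarrow> m \<in> U \<Longrightarrow> l < m"
    and "\<And>l. l \<in> L \<Longrightarrow> l < 1" "\<And>m. m \<in> U \<Longrightarrow> 0 < m"
  obtains t where "0 \<le> t" "t \<le> 1" "\<And>l. l \<in> L \<Longrightarrow> l < t" "\<And>m. m \<in> U \<Longrightarrow> t < m"
proof -
  \<comment> \<open>Inserting 0 and 1 covers empty \<open>L\<close> or \<open>U\<close> and keeps
    \<open>t\<close> inside the unit interval.\<close>
  let ?lo = "Max (insert 0 L)" and ?hi = "Min (insert 1 U)"
  have lo: "0 \<le> ?lo" "\<And>l. l \<in> L \<Longrightarrow> l \<le> ?lo" using assms(1) by auto
  have hi: "?hi \<le> 1" "\<And>m. m \<in> U \<Longrightarrow> ?hi \<le> m" using assms(2) by auto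
  have "?lo < ?hi"
    using assms by (subst Max_less_iff) auto
  then obtain t where t: "?lo < t" "t < ?hi" using dense by blast
  show ?thesis
  proof
    show "0 \<le> t" "t \<le> 1" using lo(1) hi(1) t by linarith+
    show "l < t" if "l \<in> L" for l using lo(2)[OF that] t by linarith
    show "t < m" if "m \<in> U" for m using hi(2)[OF that] t by linarith
  qed
qed

text \<open>
  Fourier--Motzkin elimination of the variable p. The constraints
  \<open>u p \<ge> 0\<close> and \<open>u p \<le> 1\<close> are combined with each inequality at once by
  minimising \<open>a p * u p\<close> over the interval, which yields \<open>min 0 (a p)\<close>.
\<close>

definition relax :: "'k \<Rightarrow> ('k \<Rightarrow> int) \<times> int \<Rightarrow> ('k \<Rightarrow> int) \<times> int" where
  "relax p = (\<lambda>(a, b). (a, b + min 0 (a p)))"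

text \<open>\<open>eliminate\<close> applies this with \<open>a p > 0 > a' p\<close>: both
  multipliers are then positive integers and the coefficient of \<open>p\<close> cancels.\<close>

definition resolve :: "'k \<Rightarrow> (('k \<Rightarrow> int) \<times> int) \<times> (('k \<Rightarrow> int) \<times> int) \<Rightarrow> ('k \<Rightarrow> int) \<times> int" where
  "resolve p = (\<lambda>((a, b), (a', b')).
     ((\<lambda>q. a p * a' q + (- a' p) * a q), a p * b' + (- a' p) * b))"

definition eliminate :: "'k \<Rightarrow> (('k \<Rightarrow> int) \<times> int) set \<Rightarrow> (('k \<Rightarrow> int) \<times> int) set" where
  "eliminate p C = relax p ` C \<union>
     resolve p ` ({c \<in> C. fst c p > 0} \<times> {c \<in> C. fst c p < 0})"

lemma feasible_eliminate:
  assumes C: "finite C" and K: "finite K" "p \<notin> K" and u: "feasible K (eliminate p C) u"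
  shows "\<exists>u. feasible (insert p K) C u"
proof -
  \<comment> \<open>The part of a constraint that \<open>u\<close> already fixes, leaving out the
    term in \<open>p\<close>.\<close>
  define r where "r = (\<lambda>(a, b). (\<Sum>q\<in>K. real_of_int (a q) * u q) + real_of_int b)"
  have r_neg: "r c < 0" if "c \<in> eliminate p C" for c
    using u that by (cases c) (auto simp: feasible_def r_def)
  have r_relax: "r (a, b) + min 0 (real_of_int (a p)) < 0" if "(a, b) \<in> C" for a b
  proof -
    have "relax p (a, b) \<in> eliminate p C" using that unfolding eliminate_def by blast
    then have "r (relax p (a, b)) < 0" by (rule r_neg)
    then show ?thesis by (simp add: r_def relax_def of_int_min)
  qed
  have r_resolve: "real_of_int (a p) * r (a', b') < real_of_int (a' p) * r (a, b)"
    if "(a, b) \<in> C" "(a', b') \<in> C" "a p > 0" "a' p < 0" for a b a' b'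
  proof -
    have "resolve p ((a, b), (a', b')) \<in> eliminate p C"
      using that unfolding eliminate_def by force
    then have "r (resolve p ((a, b), (a', b'))) < 0" by (rule r_neg)
    moreover have "r (resolve p ((a, b), (a', b'))) =
      real_of_int (a p) * r (a', b') - real_of_int (a' p) * r (a, b)"
      by (simp add: r_def resolve_def algebra_simps sum.distrib sum_subtractf sum_distrib_left)
    ultimately show ?thesis by simp
  qed
  \<comment> \<open>The value of \<open>u p\<close> that turns the constraint into an equation: a
    strict lower bound for \<open>u p\<close> if the coefficient is negative, a strict upper bound
    if it is positive.\<close>
  define bd where "bd c = - r c / real_of_int (fst c p)" for c
  let ?L = "bd ` {c \<in> C. fst c p < 0}" and ?U = "bd ` {c \<in> C. fst c p > 0}"
  obtain t where t: "0 \<le> t" "t \<le> 1" "\<And>l. l \<in> ?L \<Longrightarrow> l < t" "\<And>m. m \<in> ?U \<Longrightarrow> t < m"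
  proof (rule finite_interval_gap[of ?L ?U])
    show "finite ?L" "finite ?U" using C by auto
    show "l < m" if l: "l \<in> ?L" and m: "m \<in> ?U" for l m
    proof -
      obtain a' b' where c': "(a', b') \<in> C" "a' p < 0" "l = bd (a', b')" using l by force
      obtain a b where c: "(a, b) \<in> C" "a p > 0" "m = bd (a, b)" using m by force
      have "r (a, b) = - m * real_of_int (a p)" "r (a', b') = - l * real_of_int (a' p)"
        using c c' by (auto simp: bd_def)
      \<comment> \<open>This is the resolved inequality with \<open>r\<close> rewritten through the
        bounds; the second factor is positive and can be cancelled.\<close>
      then have "(l - m) * (real_of_int (a p) * - real_of_int (a' p)) < 0"
        using r_resolve[OF c(1) c'(1) c(2) c'(2)] by (simp add: algebra_simps)
      moreover have "0 < real_of_int (a p) * - real_of_int (a' p)"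
        using c(2) c'(2) by (intro mult_pos_pos) auto
      ultimately have "l - m < 0" by (meson mult_less_0_iff order_less_asym)
      then show ?thesis by simp
    qed
    \<comment> \<open>The relaxed inequality is the one at \<open>u p = 1\<close> if
      \<open>a p < 0\<close>, giving \<open>l < 1\<close>, and the one at \<open>u p = 0\<close> if
      \<open>a p > 0\<close>, giving \<open>0 < m\<close> below.\<close>
    show "l < 1" if l: "l \<in> ?L" for l
    proof -
      obtain a b where c: "(a, b) \<in> C" "a p < 0" "l = bd (a, b)" using l by force
      show ?thesis unfolding c(3) using r_relax[OF c(1)] c(2) by (simp add: bd_def less_divide_eq)
    qed
    show "0 < m" if m: "m \<in> ?U" for m
    proof -
      obtain a b where c: "(a, b) \<in> C" "a p > 0" "m = bd (a, b)" using m by force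
      show ?thesis unfolding c(3) using r_relax[OF c(1)] c(2)
        by (simp add: bd_def divide_neg_pos)
    qed
  qed blast
  have "(\<Sum>q\<in>insert p K. real_of_int (a q) * (u(p := t)) q) + real_of_int b < 0"
    if c: "(a, b) \<in> C" for a b
  proof -
    have "(\<Sum>q\<in>K. real_of_int (a q) * (u(p := t)) q) = (\<Sum>q\<in>K. real_of_int (a q) * u q)"
      using K by (intro sum.cong) auto
    then have eq: "(\<Sum>q\<in>insert p K. real_of_int (a q) * (u(p := t)) q) + real_of_int b
      = real_of_int (a p) * t + r (a, b)"
      using K by (simp add: r_def)
    consider "a p = 0" | "a p > 0" | "a p < 0" by linarith
    then have "real_of_int (a p) * t + r (a, b) < 0"
    proof cases
      case 1
      then show ?thesis using r_relax[OF c] by simp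
    next
      case 2
      then have "t < bd (a, b)" using c by (intro t(4)) force
      then show ?thesis using 2 by (simp add: bd_def field_simps)
    next
      case 3
      then have "bd (a, b) < t" using c by (intro t(3)) force
      then show ?thesis using 3 by (simp add: bd_def field_simps)
    qed
    then show ?thesis using eq by simp
  qed
  then have "feasible (insert p K) C (u(p := t))"
    using u t(1,2) unfolding feasible_def by auto
  then show ?thesis by blast
qed

text \<open>Pulls a combination back through one elimination step. Resolvents have coefficient 0 at
  \<open>p\<close> and lose nothing; relaxed constraints carry the term \<open>min 0 (a p)\<close>,
  which is superadditive, so sums give an inequality and not an equation.\<close>

lemma comb_eliminate:
  assumes "comb (eliminate p C) a b"
  shows "\<exists>d. comb C a d \<and> b \<le> d + min 0 (a p)"
  using assms
proof induction
  case (comb_base a b)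
  then consider "(a, b) \<in> relax p ` C"
    | "(a, b) \<in> resolve p ` ({c \<in> C. fst c p > 0} \<times> {c \<in> C. fst c p < 0})"
    unfolding eliminate_def by blast
  then show ?case
  proof cases
    case 1
    then obtain d where "(a, d) \<in> C" "b = d + min 0 (a p)" by (auto simp: relax_def)
    then show ?thesis using comb.comb_base by fastforce
  next
    case 2
    then obtain a1 b1 a2 b2 where c: "(a1, b1) \<in> C" "(a2, b2) \<in> C" "a1 p > 0" "a2 p < 0"
      and ab: "a = (\<lambda>q. a1 p * a2 q + (- a2 p) * a1 q)" "b = a1 p * b2 + (- a2 p) * b1"
      by (auto simp: resolve_def)
    have "comb C a b"
      using comb_add[OF comb_scale[OF comb.comb_base[OF c(2)], of "nat (a1 p)"]
          comb_scale[OF comb.comb_base[OF c(1)], of "nat (- a2 p)"]] c ab by simp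
    moreover have "a p = 0" using ab by simp
    ultimately show ?thesis by auto
  qed
next
  case (comb_add a b a' b')
  then obtain d d' where "comb C a d" "b \<le> d + min 0 (a p)" "comb C a' d'" "b' \<le> d' + min 0 (a' p)"
    by blast
  then have "comb C (\<lambda>q. a q + a' q) (d + d')" "b + b' \<le> (d + d') + min 0 (a p + a' p)"
    by (auto intro: comb.comb_add)
  then show ?case by blast
qed

text \<open>The left side of the conclusion is the minimum of
  \<open>b + (\<Sum>p\<in>K. a p * u p)\<close> over the unit cube, so the combination certifies
  infeasibility. Each eliminated variable contributes one \<open>min\<close> term; with no variables
  left, a violated constraint is itself the certificate.\<close>

lemma infeasible_imp_comb:
  assumes "finite K" "finite C" "C \<noteq> {}" "\<nexists>u. feasible K C u"
  shows "\<exists>a b. comb C a b \<and> b + (\<Sum>p\<in>K. min 0 (a p)) \<ge> 0"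
  using assms
proof (induction K arbitrary: C rule: finite_induct)
  case empty
  then obtain a b where "(a, b) \<in> C" "b \<ge> 0"
    unfolding feasible_def by (force simp: not_less)
  then show ?case using comb_base by fastforce
next
  case (insert p K)
  have "finite (eliminate p C)" "eliminate p C \<noteq> {}"
    using insert.prems by (auto simp: eliminate_def)
  moreover have "\<nexists>u. feasible K (eliminate p C) u"
    using feasible_eliminate[OF insert.prems(1) insert.hyps] insert.prems(3) by blast
  ultimately obtain a b where ab: "comb (eliminate p C) a b" "b + (\<Sum>q\<in>K. min 0 (a q)) \<ge> 0"
    using insert.IH[of "eliminate p C"] by blast
  obtain d where d: "comb C a d" "b \<le> d + min 0 (a p)"
    using comb_eliminate[OF ab(1)] by blast
  have "d + (\<Sum>q\<in>insert p K. min 0 (a q)) \<ge> 0"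
    using ab(2) d(2) insert.hyps by simp
  with d(1) show ?case by blast
qed

section \<open>Labelled sums\<close>

abbreviation lsum :: "(form \<Rightarrow> real) \<Rightarrow> (label \<Rightarrow> nat) \<Rightarrow> lform multiset \<Rightarrow> real" where
  "lsum v f \<Gamma> \<equiv> (\<Sum>A \<in># select f \<Gamma>. v A)"

lemma select_empty [simp]: "select f {#} = {#}"
  by (simp add: select_def)

lemma select_add_mset [simp]:
  "select f (add_mset (x, A) \<Gamma>) = (if f x = 1 then add_mset A (select f \<Gamma>) else select f \<Gamma>)"
  by (simp add: select_def)

lemma set_select: "set_mset (select f \<Gamma>) \<subseteq> snd ` set_mset \<Gamma>"
  by (auto simp: select_def)

text \<open>There are infinitely many labellings, but elimination needs a finite system.\<close>

lemma finite_range_select: "finite (range (\<lambda>f. select f \<Gamma>))"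
proof (induction \<Gamma>)
  case empty
  then show ?case by simp
next
  case (add p \<Gamma>)
  have "range (\<lambda>f. select f (add_mset p \<Gamma>)) \<subseteq>
    range (\<lambda>f. select f \<Gamma>) \<union> add_mset (snd p) ` range (\<lambda>f. select f \<Gamma>)"
    by (cases p) auto
  then show ?case using add by (meson finite_UnI finite_imageI finite_subset)
qed

lemma select_cong:
  assumes "\<And>x A. (x, A) \<in># \<Gamma> \<Longrightarrow> f x = g x"
  shows "select f \<Gamma> = select g \<Gamma>"
proof -
  have "{# (x, A) \<in># \<Gamma>. f x = 1 #} = {# (x, A) \<in># \<Gamma>. g x = 1 #}"
    using assms by (intro filter_mset_cong) auto
  then show ?thesis by (simp add: select_def)
qed

lemma labelling_cases: "labelling f \<Longrightarrow> f x = 0 \<or> f x = 1"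
  by (auto simp: labelling_def)

lemma labelling_Conc: "labelling f \<Longrightarrow> f (x \<cdot> y) = f x * f y"
  by (auto simp: labelling_def)

section \<open>Labelling functions and valuations built from their values on atoms\<close>

primrec extend_label :: "(nat \<Rightarrow> nat) \<Rightarrow> label \<Rightarrow> nat" where
  "extend_label h One = 1"
| "extend_label h (Atom k) = h k"
| "extend_label h (x \<cdot> y) = extend_label h x * extend_label h y"

lemma labelling_extend_label:
  assumes "\<And>k. h k \<in> {0, 1}"
  shows "labelling (extend_label h)"
proof -
  have "extend_label h x \<in> {0, 1}" for x
  proof (induction x)
    case (Atom k)
    then show ?case using assms by simp
  qed auto
  then show ?thesis by (simp add: labelling_def)
qed

text \<open>The use of freshness: the value at \<open>y\<close> can be reset without disturbing
  labels that do not contain \<open>y\<close>.\<close>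

lemma extend_label_update:
  assumes "labelling f" "y \<notin> atoms x"
  shows "extend_label ((\<lambda>k. f (Atom k))(y := c)) x = f x"
  using assms by (induction x) (auto simp: labelling_def)

fun extend_val :: "(nat \<Rightarrow> real) \<Rightarrow> form \<Rightarrow> real" where
  "extend_val u (Var p) = u p"
| "extend_val u \<bottom>\<^sub>L = -1"
| "extend_val u (A \<Rightarrow>\<^sub>L B) = min 0 (extend_val u B - extend_val u A)"

lemma valuation_extend_val:
  assumes "\<And>p. u p \<in> {-1..0}"
  shows "valuation (extend_val u)"
proof -
  have "extend_val u A \<in> {-1..0}" for A
    using assms by (induction A) auto
  then show ?thesis by (simp add: valuation_def)
qed

section \<open>The logical rules preserve and reflect validity\<close>

text \<open>When \<open>x\<close> has value 1, the value of \<open>y\<close> chooses between 0 and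
  \<open>v B - v A\<close>. Either choice bounds their minimum from above, and the better choice
  attains it.\<close>

lemma valid_impL:
  assumes "\<not> occurs_in y (add_mset (x, A \<Rightarrow>\<^sub>L B) \<Gamma>, \<Delta>)"
  shows "\<Turnstile>\<^sup>* (add_mset (x \<cdot> Atom y, B) \<Gamma>, add_mset (x \<cdot> Atom y, A) \<Delta>) \<longleftrightarrow>
         \<Turnstile>\<^sup>* (add_mset (x, A \<Rightarrow>\<^sub>L B) \<Gamma>, \<Delta>)" (is "?P \<longleftrightarrow> ?C")
proof
  assume P: ?P
  show ?C
    unfolding valid_def
  proof (intro allI impI)
    fix v assume v: "valuation v"
    then obtain f where f: "labelling f"
      "lsum v f (add_mset (x \<cdot> Atom y, B) \<Gamma>) \<le> lsum v f (add_mset (x \<cdot> Atom y, A) \<Delta>)"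
      using P unfolding valid_def by auto
    have "lsum v f (add_mset (x, A \<Rightarrow>\<^sub>L B) \<Gamma>) \<le> lsum v f \<Delta>"
      using f labelling_cases[OF f(1), of x] labelling_cases[OF f(1), of "Atom y"] v
      by (auto simp: labelling_Conc valuation_def)
    then show "\<exists>f. labelling f \<and>
        lsum v f (fst (add_mset (x, A \<Rightarrow>\<^sub>L B) \<Gamma>, \<Delta>)) \<le> lsum v f (snd (add_mset (x, A \<Rightarrow>\<^sub>L B) \<Gamma>, \<Delta>))"
      unfolding fst_conv snd_conv using f(1) by blast
  qed
next
  assume C: ?C
  show ?P
    unfolding valid_def
  proof (intro allI impI)
    fix v assume v: "valuation v"
    then obtain f where f: "labelling f" "lsum v f (add_mset (x, A \<Rightarrow>\<^sub>L B) \<Gamma>) \<le> lsum v f \<Delta>"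
      using C unfolding valid_def by auto
    \<comment> \<open>\<open>y\<close> gets 1 exactly when \<open>v B - v A\<close> is the
      minimum.\<close>
    define h where "h = (\<lambda>k. f (Atom k))(y := if v B \<le> v A then 1 else 0)"
    have g: "labelling (extend_label h)"
      using labelling_cases[OF f(1)] by (intro labelling_extend_label) (auto simp: h_def)
    have fresh: "y \<notin> atoms z" if "z = x \<or> (\<exists>D. (z, D) \<in># \<Gamma> + \<Delta>)" for z
      using assms that unfolding occurs_in_def by auto
    have gf: "extend_label h z = f z" if "z = x \<or> (\<exists>D. (z, D) \<in># \<Gamma> + \<Delta>)" for z
      unfolding h_def using extend_label_update[OF f(1) fresh[OF that]] .
    have sel: "select (extend_label h) \<Gamma> = select f \<Gamma>" "select (extend_label h) \<Delta> = select f \<Delta>"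
      by (intro select_cong gf; auto)+
    have "lsum v (extend_label h) (add_mset (x \<cdot> Atom y, B) \<Gamma>)
        \<le> lsum v (extend_label h) (add_mset (x \<cdot> Atom y, A) \<Delta>)"
      using f(2) v labelling_cases[OF f(1), of x] sel gf[of x]
      by (auto simp: h_def valuation_def)
    then show "\<exists>f. labelling f \<and>
        lsum v f (fst (add_mset (x \<cdot> Atom y, B) \<Gamma>, add_mset (x \<cdot> Atom y, A) \<Delta>))
        \<le> lsum v f (snd (add_mset (x \<cdot> Atom y, B) \<Gamma>, add_mset (x \<cdot> Atom y, A) \<Delta>))"
      unfolding fst_conv snd_conv using g by blast
  qed
qed

text \<open>The premises may use different labellings, so the argument fixes \<open>v\<close>.
  According to whether \<open>v A \<le> v B\<close>, one premise is equivalent to the conclusion for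
  each labelling, and the other premise follows with the same labelling.\<close>

lemma valid_impR:
  "\<Turnstile>\<^sup>* (\<Gamma>, add_mset (x, A \<Rightarrow>\<^sub>L B) \<Delta>) \<longleftrightarrow>
   \<Turnstile>\<^sup>* (add_mset (x, A) \<Gamma>, add_mset (x, B) \<Delta>) \<and> \<Turnstile>\<^sup>* (\<Gamma>, \<Delta>)"
proof -
  have "(\<exists>f. labelling f \<and> lsum v f \<Gamma> \<le> lsum v f (add_mset (x, A \<Rightarrow>\<^sub>L B) \<Delta>)) \<longleftrightarrow>
    (\<exists>f. labelling f \<and> lsum v f (add_mset (x, A) \<Gamma>) \<le> lsum v f (add_mset (x, B) \<Delta>)) \<and>
    (\<exists>f. labelling f \<and> lsum v f \<Gamma> \<le> lsum v f \<Delta>)" if v: "valuation v" for v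
  proof (cases "v A \<le> v B")
    case True
    with v have "v (A \<Rightarrow>\<^sub>L B) = 0" by (simp add: valuation_def)
    then have "lsum v f (add_mset (x, A \<Rightarrow>\<^sub>L B) \<Delta>) = lsum v f \<Delta>"
      and "lsum v f \<Gamma> \<le> lsum v f \<Delta> \<Longrightarrow>
        lsum v f (add_mset (x, A) \<Gamma>) \<le> lsum v f (add_mset (x, B) \<Delta>)" for f
      using True by auto
    then show ?thesis by metis
  next
    case False
    with v have "v (A \<Rightarrow>\<^sub>L B) = v B - v A" by (simp add: valuation_def)
    then have "lsum v f \<Gamma> \<le> lsum v f (add_mset (x, A \<Rightarrow>\<^sub>L B) \<Delta>) \<longleftrightarrow>
        lsum v f (add_mset (x, A) \<Gamma>) \<le> lsum v f (add_mset (x, B) \<Delta>)"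
      and "lsum v f \<Gamma> \<le> lsum v f (add_mset (x, A \<Rightarrow>\<^sub>L B) \<Delta>) \<Longrightarrow> lsum v f \<Gamma> \<le> lsum v f \<Delta>" for f
      using False by (auto split: if_splits)
    then show ?thesis by metis
  qed
  then show ?thesis unfolding valid_def fst_conv snd_conv by blast
qed

section \<open>The success rule\<close>

text \<open>Surplus formulas on the left have values at most 0, and \<open>\<bottom>\<^sub>L\<close>
  has the least possible value, so pairing it with any \<open>q\<close> is safe.\<close>

lemma substar_sum_le:
  assumes "\<Delta> \<subseteq>\<^sup>* \<Gamma>" "valuation v"
  shows "(\<Sum>A\<in>#\<Gamma>. v A) \<le> (\<Sum>B\<in>#\<Delta>. v B)"
  using assms(1)
proof induction
  case (incl \<Delta> \<Gamma>)
  then obtain \<Xi> where \<Gamma>: "\<Gamma> = \<Delta> + \<Xi>" by (auto simp: mset_subset_eq_exists_conv)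
  have "(\<Sum>A\<in>#\<Xi>. v A) \<le> (\<Sum>A\<in>#\<Xi>. 0)"
    using assms(2) by (intro sum_mset_mono) (auto simp: valuation_def)
  then show ?case by (simp add: \<Gamma>)
next
  case (bot q \<Delta> \<Gamma>)
  moreover have "v \<bottom>\<^sub>L = -1" "-1 \<le> v q" using assms(2) by (auto simp: valuation_def)
  ultimately show ?case by simp
qed

lemma sum_mset_sum_image:
  "(\<Sum>A\<in>#(\<Sum>i\<in>I. M i). v A) = (\<Sum>i\<in>I. \<Sum>A\<in>#M i. (v A :: real))"
  by (induction I rule: infinite_finite_induct) auto

text \<open>If every \<open>f i\<close> failed under \<open>v\<close>, adding the strict
  inequalities would contradict the previous bound; \<open>n \<ge> 1\<close> keeps the sum
  strict.\<close>

lemma valid_success: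
  assumes "(n :: nat) \<ge> 1" "\<forall>i\<in>{1..n}. labelling (f i)"
    and sub: "(\<Sum>i = 1..n. select (f i) \<Delta>) \<subseteq>\<^sup>* (\<Sum>i = 1..n. select (f i) \<Gamma>)"
  shows "\<Turnstile>\<^sup>* (\<Gamma>, \<Delta>)"
  unfolding valid_def fst_conv snd_conv
proof (intro allI impI, rule ccontr)
  fix v assume v: "valuation v"
    and "\<nexists>f. labelling f \<and> lsum v f \<Gamma> \<le> lsum v f \<Delta>"
  then have "lsum v (f i) \<Delta> < lsum v (f i) \<Gamma>" if "i \<in> {1..n}" for i
    using assms(2) that by (meson not_le)
  then have "(\<Sum>i = 1..n. lsum v (f i) \<Delta>) < (\<Sum>i = 1..n. lsum v (f i) \<Gamma>)"
    using assms(1) by (intro sum_strict_mono) auto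
  then show False using substar_sum_le[OF sub v] by (simp add: sum_mset_sum_image)
qed

section \<open>From counts of atoms to the multiset condition\<close>

lemma substar_add_bots:
  assumes "\<forall>q\<in>#\<Xi>. atomic q" "\<Delta> \<subseteq>\<^sup>* \<Gamma>"
  shows "\<Delta> + \<Xi> \<subseteq>\<^sup>* \<Gamma> + replicate_mset (size \<Xi>) \<bottom>\<^sub>L"
  using assms by (induction \<Xi>) (auto intro: substar.bot)

text \<open>The excess of \<open>\<Delta>\<close> over \<open>\<Gamma>\<close> consists of variables
  only, and its size is the negated sum of the \<open>min\<close> terms. The surplus of
  \<open>\<bottom>\<^sub>L\<close> in \<open>\<Gamma>\<close> is large enough to pay for each of
  them.\<close>

lemma substar_of_counts:
  assumes at: "\<forall>q\<in>#\<Delta>. atomic q" and K: "finite K" "\<And>p. Var p \<in># \<Delta> \<Longrightarrow> p \<in> K"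
    and cnt: "(int (count \<Gamma> \<bottom>\<^sub>L) - int (count \<Delta> \<bottom>\<^sub>L)) +
      (\<Sum>p\<in>K. min 0 (int (count \<Gamma> (Var p)) - int (count \<Delta> (Var p)))) \<ge> 0"
  shows "\<Delta> \<subseteq>\<^sup>* \<Gamma>"
proof -
  define \<Xi> where "\<Xi> = \<Delta> - \<Gamma>"
  have "(\<Sum>p\<in>K. min 0 (int (count \<Gamma> (Var p)) - int (count \<Delta> (Var p)))) \<le> 0"
    by (intro sum_nonpos) auto
  with cnt have bots: "count \<Delta> \<bottom>\<^sub>L \<le> count \<Gamma> \<bottom>\<^sub>L" by linarith
  have sub: "set_mset \<Xi> \<subseteq> Var ` K"
  proof
    fix q assume q: "q \<in># \<Xi>"
    then have "q \<in># \<Delta>" "q \<noteq> \<bottom>\<^sub>L"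
      using bots by (auto simp: \<Xi>_def in_diff_count not_in_iff intro: ccontr)
    then show "q \<in> Var ` K" using at K(2) by (cases q) fastforce+
  qed
  have "int (size \<Xi>) = (\<Sum>q\<in>Var ` K. int (count \<Xi> q))"
    unfolding size_multiset_overloaded_eq of_nat_sum
    using sub K(1) by (intro sum.mono_neutral_left) (auto simp: not_in_iff)
  also have "\<dots> = (\<Sum>p\<in>K. int (count \<Xi> (Var p)))"
    by (subst sum.reindex) (auto simp: inj_on_def)
  also have "\<dots> = - (\<Sum>p\<in>K. min 0 (int (count \<Gamma> (Var p)) - int (count \<Delta> (Var p))))"
    unfolding sum_negf[symmetric] by (intro sum.cong) (auto simp: \<Xi>_def)
  finally have "size \<Xi> \<le> count (\<Gamma> - \<Delta>) \<bottom>\<^sub>L" using cnt bots by simp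
  then have "replicate_mset (size \<Xi>) \<bottom>\<^sub>L \<subseteq># \<Gamma> - \<Delta>"
    by (simp only: count_le_replicate_mset_subset_eq)
  then obtain R where R: "\<Gamma> - \<Delta> = R + replicate_mset (size \<Xi>) \<bottom>\<^sub>L"
    by (metis subset_mset.diff_add)
  have \<Gamma>: "\<Gamma> = (\<Gamma> \<inter># \<Delta> + R) + replicate_mset (size \<Xi>) \<bottom>\<^sub>L"
    unfolding add.assoc R[symmetric] by (simp add: multiset_eq_iff min_def)
  have \<Delta>: "\<Delta> = \<Gamma> \<inter># \<Delta> + \<Xi>"
    by (simp add: multiset_eq_iff \<Xi>_def min_def)
  have "\<forall>q\<in>#\<Xi>. atomic q" using at by (auto simp: \<Xi>_def dest: in_diffD)
  then have "\<Gamma> \<inter># \<Delta> + \<Xi> \<subseteq>\<^sup>* (\<Gamma> \<inter># \<Delta> + R) + replicate_mset (size \<Xi>) \<bottom>\<^sub>L"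
    by (intro substar_add_bots substar.incl) auto
  then show ?thesis using \<Gamma> \<Delta> by simp
qed

section \<open>Valid atomic sequents as infeasible linear systems\<close>

lemma sum_mset_atomic:
  assumes "\<forall>q\<in>#M. atomic q" "finite K" "\<And>p. Var p \<in># M \<Longrightarrow> p \<in> K"
  shows "(\<Sum>A\<in>#M. extend_val u A) = (\<Sum>p\<in>K. of_nat (count M (Var p)) * u p) - of_nat (count M \<bottom>\<^sub>L)"
  using assms
proof (induction M)
  case empty
  then show ?case by simp
next
  case (add q M)
  show ?case
  proof (cases q)
    case (Var r)
    then have r: "r \<in> K" using add.prems by auto
    have "(\<Sum>p\<in>K. of_nat (count (add_mset q M) (Var p)) * u p)
      = (\<Sum>p\<in>K. of_nat (count M (Var p)) * u p + (if p = r then u p else 0))"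
      using Var by (intro sum.cong) (auto simp: algebra_simps)
    also have "\<dots> = (\<Sum>p\<in>K. of_nat (count M (Var p)) * u p) + u r"
      using r add.prems(2) by (simp add: sum.distrib)
    finally show ?thesis using add Var by simp
  next
    case Bot
    then show ?thesis using add by simp
  next
    case Imp
    then show ?thesis using add by simp
  qed
qed

text \<open>Expresses that \<open>f\<close> fails: under \<open>v p = - u p\<close>, the inequality
  \<open>lsum v f \<Gamma> > lsum v f \<Delta>\<close> becomes
  \<open>(\<Sum>p. a p * u p) + b < 0\<close>, with \<open>\<bottom>\<^sub>L\<close> supplying the
  constant.\<close>

definition constraint :: "sequent \<Rightarrow> (label \<Rightarrow> nat) \<Rightarrow> (nat \<Rightarrow> int) \<times> int" where
  "constraint S f =
     (let d = (\<lambda>q. int (count (select f (fst S)) q) - int (count (select f (snd S)) q))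
      in (\<lambda>p. d (Var p), d \<bottom>\<^sub>L))"

lemma finite_constraints: "finite (constraint S ` Collect labelling)"
proof -
  have "constraint S ` Collect labelling \<subseteq>
    (\<lambda>(M, N). (let d = (\<lambda>q. int (count M q) - int (count N q)) in (\<lambda>p. d (Var p), d \<bottom>\<^sub>L))) `
    (range (\<lambda>f. select f (fst S)) \<times> range (\<lambda>f. select f (snd S)))"
    by (force simp: constraint_def)
  then show ?thesis
    by (rule finite_subset) (intro finite_imageI finite_cartesian_product finite_range_select)
qed

text \<open>Recovers the labellings behind a combination. A list records repetitions, and its being
  nonempty gives \<open>n \<ge> 1\<close>.\<close>

lemma comb_constraints:
  assumes "comb (constraint S ` Collect labelling) a b"
  shows "\<exists>fs. fs \<noteq> [] \<and> (\<forall>f\<in>set fs. labelling f) \<and>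
    (\<lambda>q. \<Sum>f\<leftarrow>fs. fst (constraint S f) q) = a \<and> (\<Sum>f\<leftarrow>fs. snd (constraint S f)) = b"
  using assms
proof induction
  case (comb_base a b)
  then obtain f where "labelling f" "constraint S f = (a, b)" by auto
  then show ?case by (intro exI[of _ "[f]"]) auto
next
  case (comb_add a b a' b')
  then obtain fs gs where "fs \<noteq> []" "\<forall>f\<in>set fs. labelling f" "\<forall>f\<in>set gs. labelling f"
    "(\<lambda>q. \<Sum>f\<leftarrow>fs. fst (constraint S f) q) = a" "(\<Sum>f\<leftarrow>fs. snd (constraint S f)) = b"
    "(\<lambda>q. \<Sum>f\<leftarrow>gs. fst (constraint S f) q) = a'" "(\<Sum>f\<leftarrow>gs. snd (constraint S f)) = b'"
    by blast
  then show ?case by (intro exI[of _ "fs @ gs"]) auto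
qed

lemma set_mset_sum_list: "set_mset (\<Sum>f\<leftarrow>fs. M f) = (\<Union>f\<in>set fs. set_mset (M f))"
  by (induction fs) auto

lemma derivable_atomic:
  assumes at: "\<forall>(x, A) \<in># \<Gamma> + \<Delta>. atomic A" and valid: "\<Turnstile>\<^sup>* (\<Gamma>, \<Delta>)"
  shows "derivable (\<Gamma>, \<Delta>)"
proof -
  let ?C = "constraint (\<Gamma>, \<Delta>) ` Collect labelling"
  define K where "K = {p. Var p \<in> snd ` set_mset (\<Gamma> + \<Delta>)}"
  have "finite (Var -` (snd ` set_mset (\<Gamma> + \<Delta>)))"
    by (intro finite_vimageI) (auto simp: inj_on_def)
  then have K: "finite K" by (simp add: K_def vimage_def)
  have selK: "p \<in> K" if "Var p \<in># select f \<Gamma> \<or> Var p \<in># select f \<Delta>" for f p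
    using that set_select[of f \<Gamma>] set_select[of f \<Delta>] by (auto simp: K_def)
  have selat: "atomic q" if "q \<in># select f \<Gamma> \<or> q \<in># select f \<Delta>" for f q
    using that set_select[of f \<Gamma>] set_select[of f \<Delta>] at by fastforce
  have "\<nexists>u. feasible K ?C u"
  proof
    assume "\<exists>u. feasible K ?C u"
    then obtain u where u: "feasible K ?C u" ..
    define v where "v = extend_val (\<lambda>p. - u p)"
    have "valuation v"
      unfolding v_def using u by (intro valuation_extend_val) (auto simp: feasible_def)
    then obtain f where f: "labelling f" "lsum v f \<Gamma> \<le> lsum v f \<Delta>"
      using valid unfolding valid_def by auto
    \<comment> \<open>Feasibility says that every labelling fails under \<open>v\<close>, including
      the one that validity supplies.\<close>
    have "(\<Sum>p\<in>K. of_int (fst (constraint (\<Gamma>, \<Delta>) f) p) * u p)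
        + of_int (snd (constraint (\<Gamma>, \<Delta>) f)) < 0"
      using u f(1) unfolding feasible_def by fastforce
    moreover have "lsum v f \<Gamma> = (\<Sum>p\<in>K. of_nat (count (select f \<Gamma>) (Var p)) * - u p)
        - of_nat (count (select f \<Gamma>) \<bottom>\<^sub>L)"
      "lsum v f \<Delta> = (\<Sum>p\<in>K. of_nat (count (select f \<Delta>) (Var p)) * - u p)
        - of_nat (count (select f \<Delta>) \<bottom>\<^sub>L)"
      unfolding v_def using selK selat K by (intro sum_mset_atomic; blast)+
    ultimately show False using f(2)
      by (simp add: constraint_def Let_def sum_subtractf algebra_simps sum_negf)
  qed
  \<comment> \<open>Some labelling exists, so the system of constraints is nonempty.\<close>
  moreover have "labelling (\<lambda>_. 1)" by (simp add: labelling_def)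
  ultimately obtain a b where ab: "comb ?C a b" "b + (\<Sum>p\<in>K. min 0 (a p)) \<ge> 0"
    using infeasible_imp_comb[OF K finite_constraints, of "(\<Gamma>, \<Delta>)"] by blast
  from comb_constraints[OF ab(1)] obtain fs where fs: "fs \<noteq> []" "\<forall>f\<in>set fs. labelling f"
    and a: "a = (\<lambda>q. \<Sum>f\<leftarrow>fs. fst (constraint (\<Gamma>, \<Delta>) f) q)"
    and b: "b = (\<Sum>f\<leftarrow>fs. snd (constraint (\<Gamma>, \<Delta>) f))" by blast
  have diff: "(\<Sum>f\<leftarrow>fs. int (count (select f \<Gamma>) q) - int (count (select f \<Delta>) q))
      = int (count (\<Sum>f\<leftarrow>fs. select f \<Gamma>) q) - int (count (\<Sum>f\<leftarrow>fs. select f \<Delta>) q)" for q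
    by (induction fs) auto
  have "(\<Sum>f\<leftarrow>fs. select f \<Delta>) \<subseteq>\<^sup>* (\<Sum>f\<leftarrow>fs. select f \<Gamma>)"
  proof (rule substar_of_counts[OF _ K])
    show "\<forall>q\<in>#(\<Sum>f\<leftarrow>fs. select f \<Delta>). atomic q"
      using selat by (auto simp: set_mset_sum_list)
    show "p \<in> K" if "Var p \<in># (\<Sum>f\<leftarrow>fs. select f \<Delta>)" for p
      using selK that by (auto simp: set_mset_sum_list)
    show "0 \<le> int (count (\<Sum>f\<leftarrow>fs. select f \<Gamma>) \<bottom>\<^sub>L) - int (count (\<Sum>f\<leftarrow>fs. select f \<Delta>) \<bottom>\<^sub>L) +
      (\<Sum>p\<in>K. min 0 (int (count (\<Sum>f\<leftarrow>fs. select f \<Gamma>) (Var p)) -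
        int (count (\<Sum>f\<leftarrow>fs. select f \<Delta>) (Var p))))"
      using ab(2) unfolding a b constraint_def Let_def fst_conv snd_conv diff .
  qed
  \<comment> \<open>Lists are indexed from 0, the success rule from 1.\<close>
  moreover have "(\<Sum>f\<leftarrow>fs. M f) = (\<Sum>i = 1..length fs. M (fs ! (i - 1)))"
    for M :: "_ \<Rightarrow> form multiset"
    by (simp add: sum_list_sum_nth atLeast0LessThan sum.atLeast1_atMost_eq)
  ultimately show ?thesis
    using fs at
    by (intro derivable.success[where n = "length fs" and f = "\<lambda>i. fs ! (i - 1)"])
      (auto simp: Suc_le_eq)
qed

section \<open>Soundness and completeness\<close>

lemma derivable_imp_valid: "derivable S \<Longrightarrow> \<Turnstile>\<^sup>* S"
proof (induction rule: derivable.induct)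
  case (impL x y B \<Gamma> A \<Delta>)
  then show ?case using valid_impL by blast
next
  case (impR x A \<Gamma> B \<Delta>)
  then show ?case using valid_impR by blast
next
  case (success \<Gamma> \<Delta> n f)
  then show ?case using valid_success by blast
qed

section \<open>Backward proof search down to atomic sequents\<close>

lemma finite_atoms: "finite (atoms x)"
  by (induction x) auto

lemma fresh_atom: "\<exists>y. \<not> occurs_in y S"
proof -
  have "finite (\<Union>(x, A)\<in>set_mset (fst S + snd S). atoms x)"
    by (auto simp: finite_atoms)
  then obtain y where "y \<notin> (\<Union>(x, A)\<in>set_mset (fst S + snd S). atoms x)"
    using ex_new_if_finite infinite_UNIV_nat by blast
  then show ?thesis unfolding occurs_in_def by blast
qed

lemma not_atomicE:
  assumes "\<not> atomic D"
  obtains A B where "D = A \<Rightarrow>\<^sub>L B"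
  using assms by (cases D) auto

text \<open>Total formula size decreases from conclusion to premises: \<open>A\<close> and
  \<open>B\<close> together are smaller than \<open>A \<Rightarrow>\<^sub>L B\<close>, even when
  they land on opposite sides. Validity passes to the premises by the two equivalences.\<close>

lemma valid_imp_derivable: "\<Turnstile>\<^sup>* (\<Gamma>, \<Delta>) \<Longrightarrow> derivable (\<Gamma>, \<Delta>)"
proof (induction "\<Sum>(x, A)\<in>#\<Gamma> + \<Delta>. size A" arbitrary: \<Gamma> \<Delta> rule: less_induct)
  case less
  consider (left) x D where "(x, D) \<in># \<Gamma>" "\<not> atomic D" | (right) x D where "(x, D) \<in># \<Delta>" "\<not> atomic D"
    | (atomic) "\<forall>(x, A) \<in># \<Gamma> + \<Delta>. atomic A" by fastforce
  then show ?case
  proof cases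
    case left
    then obtain A B \<Gamma>' where \<Gamma>: "\<Gamma> = add_mset (x, A \<Rightarrow>\<^sub>L B) \<Gamma>'"
      by (metis not_atomicE multi_member_split)
    obtain y where y: "\<not> occurs_in y (add_mset (x, A \<Rightarrow>\<^sub>L B) \<Gamma>', \<Delta>)"
      using fresh_atom by blast
    have "derivable (add_mset (x \<cdot> Atom y, B) \<Gamma>', add_mset (x \<cdot> Atom y, A) \<Delta>)"
      using less.prems valid_impL[OF y] \<Gamma> by (intro less.hyps) auto
    then show ?thesis unfolding \<Gamma> using y by (rule derivable.impL)
  next
    case right
    then obtain A B \<Delta>' where \<Delta>: "\<Delta> = add_mset (x, A \<Rightarrow>\<^sub>L B) \<Delta>'"
      by (metis not_atomicE multi_member_split)
    have "derivable (add_mset (x, A) \<Gamma>, add_mset (x, B) \<Delta>')"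
      using less.prems valid_impR \<Delta> by (intro less.hyps) auto
    moreover have "derivable (\<Gamma>, \<Delta>')"
      using less.prems valid_impR \<Delta> by (intro less.hyps) auto
    ultimately show ?thesis unfolding \<Delta> by (rule derivable.impR)
  next
    case atomic
    then show ?thesis using derivable_atomic less.prems by blast
  qed
qed

theorem mainTheorem16:
  fixes S :: sequent
  shows "derivable S \<longleftrightarrow> \<Turnstile>\<^sup>* S"
  using derivable_imp_valid valid_imp_derivable by (cases S) blast

end
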